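(* For every $\gamma\in[0,1]$ and every instance of MP-KHD, let $H$ be the total number of successful assignments (selected and accepted) made by $\mathsf{SAMP}(\gamma)$. Then $\mathrm{Var}[H]\le\bar\gamma(1-\bar\gamma)B$, where $\bar\gamma=\min(1/2,\gamma)$ and $B=\sum_{i\in I}b_i$.
   Context: An instance of MP-KHD consists of: a bipartite graph $G=(I,J,E)$ with finite sets $I$ (offline agent types) and $J$ (online agent types); a finite set of prices $\{a_1,\dots,a_K\}$; a capacity $b_i\in\mathbb{Z}_{>0}$ for each $i\in I$; a horizon $T\in\mathbb{Z}_{>0}$; for each $t\in[T]$ a probability distribution $(q_{j,t})_{j\in J}$ on $J$; the assignment set $\mathcal{F}=\{(i,j,k):(i,j)\in E,k\in[K]\}$; for each $f\in\mathcal{F}$, $t\in[T]$, an acceptance probability $p_{f,t}\in(0,1]$ and profit $w_{f,t}\ge0$. $\mathcal{F}_j$ ($\mathcal{F}_i$) is the set of assignments with second (first) coordinate $j$ ($i$). The instance is known in advance. In each round $t$, an online agent type $\hat j_t$ arrives, independently across rounds, with $\Pr[\hat j_t=j]=q_{j,t}$; the policy irrevocably rejects it or selects one $f=(i,\hat j_t,k)\in\mathcal{F}_{\hat j_t}$ with $i$ having remaining capacity; the agent independently accepts with probability $p_{f,t}$ (then $i$'s capacity drops by one and profit $w_{f,t}$ is earned), else nothing happens. The variance is over arrivals, the policy's internal randomness, and acceptance outcomes. Policy $\mathsf{SAMP}(\gamma)$, $\gamma\in[0,1]$: replace each offline type $i$ by $b_i$ copies of capacity 1 (inheriting $i$'s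 edges, probabilities and profits), and work with this unit-capacity instance. Solve the LP $\max\sum_{t,f}x_{f,t}p_{f,t}w_{f,t}$ s.t. $\sum_{f\in\mathcal{F}_j}x_{f,t}\le q_{j,t}$ for all $j,t$; $\sum_t\sum_{f\in\mathcal{F}_i}x_{f,t}p_{f,t}\le1$ for all $i$; $x\ge0$; let $x$ be an optimal solution. In round $t$, when $j$ arrives, sample at most one assignment, choosing each $f\in\mathcal{F}_j$ with probability $\gamma x_{f,t}/q_{j,t}$; if some $f=(i,j,k)$ is sampled and $i$ still has its unit of capacity, select $f$; otherwise reject. *)

theory Defs
  imports "HOL-Probability.Probability"
begin

section \<open>Instances of MP-KHD\<close>

text \<open>An assignment \<open>(i, j, k)\<close> offers the \<open>k\<close>-th price to an online agent of type \<open>j\<close> for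
  the offline type \<open>i\<close>.\<close>

type_synonym ('i, 'j) assignment = "'i \<times> 'j \<times> nat"

text \<open>Prices are \<open>price M 1, \<dots>, price M (num_prices M)\<close> and rounds are \<open>1, \<dots>, horizon M\<close>;
  the values of the fields outside these index ranges (and of \<open>accept\<close> and \<open>profit\<close> outside the
  assignment set) are irrelevant. The probability $q_{j,t}$ is \<open>pmf (arrival M t) j\<close>.\<close>

record ('i, 'j) khd =
  offline :: "'i set"
  online :: "'j set"
  edges :: "('i \<times> 'j) set"
  num_prices :: nat
  price :: "nat \<Rightarrow> real"
  capacity :: "'i \<Rightarrow> nat"
  horizon :: nat
  arrival :: "nat \<Rightarrow> 'j pmf"
  accept :: "('i, 'j) assignment \<Rightarrow> nat \<Rightarrow> real"
  profit :: "('i, 'j) assignment \<Rightarrow> nat \<Rightarrow> real"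

definition assignments :: "('i, 'j) khd \<Rightarrow> ('i, 'j) assignment set" where
  "assignments M = {(i, j, k). (i, j) \<in> edges M \<and> k \<in> {1..num_prices M}}"

definition assignments_on :: "('i, 'j) khd \<Rightarrow> 'j \<Rightarrow> ('i, 'j) assignment set" where
  "assignments_on M j = {f \<in> assignments M. fst (snd f) = j}"

definition assignments_off :: "('i, 'j) khd \<Rightarrow> 'i \<Rightarrow> ('i, 'j) assignment set" where
  "assignments_off M i = {f \<in> assignments M. fst f = i}"

definition mp_khd :: "('i, 'j) khd \<Rightarrow> bool" where
  "mp_khd M \<longleftrightarrow>
     finite (offline M) \<and> finite (online M) \<and> edges M \<subseteq> offline M \<times> online M \<and>
     (\<forall>i\<in>offline M. capacity M i > 0) \<and> horizon M > 0 \<and>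
     (\<forall>t\<in>{1..horizon M}. set_pmf (arrival M t) \<subseteq> online M) \<and>
     (\<forall>f\<in>assignments M. \<forall>t\<in>{1..horizon M}.
        0 < accept M f t \<and> accept M f t \<le> 1 \<and> 0 \<le> profit M f t)"


section \<open>Running a policy\<close>

text \<open>One entry per past round: the arriving type, the selected assignment (\<open>None\<close> if the agent
  was rejected), and whether the selected assignment was accepted (\<open>False\<close> after a rejection).\<close>

type_synonym ('i, 'j) history = "('j \<times> ('i, 'j) assignment option \<times> bool) list"

text \<open>The (possibly randomised) selection made for the arriving type in the given round. The
  randomness used by a policy in different rounds is conditionally independent given the history.\<close>

type_synonym ('i, 'j) policy =
  "('i, 'j) history \<Rightarrow> nat \<Rightarrow> 'j \<Rightarrow> ('i, 'j) assignment option pmf"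

definition successes :: "('i, 'j) history \<Rightarrow> ('i, 'j) assignment list" where
  "successes h = [f. (j, Some f, True) \<leftarrow> h]"

definition num_successes :: "('i, 'j) history \<Rightarrow> nat" where
  "num_successes h = length (successes h)"

definition has_capacity :: "('i, 'j) khd \<Rightarrow> ('i, 'j) history \<Rightarrow> 'i \<Rightarrow> bool" where
  "has_capacity M h i \<longleftrightarrow> length (filter (\<lambda>f. fst f = i) (successes h)) < capacity M i"

definition acceptance :: "('i, 'j) khd \<Rightarrow> nat \<Rightarrow> ('i, 'j) assignment option \<Rightarrow> bool pmf" where
  "acceptance M t s =
     (case s of None \<Rightarrow> return_pmf False | Some f \<Rightarrow> bernoulli_pmf (accept M f t))"

primrec run :: "('i, 'j) khd \<Rightarrow> ('i, 'j) policy \<Rightarrow> nat \<Rightarrow> ('i, 'j) history pmf" where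
  "run M P 0 = return_pmf []"
| "run M P (Suc n) =
     bind_pmf (run M P n) (\<lambda>h.
     bind_pmf (arrival M (Suc n)) (\<lambda>j.
     bind_pmf (P h (Suc n) j) (\<lambda>s.
     bind_pmf (acceptance M (Suc n) s) (\<lambda>a.
     return_pmf (h @ [(j, s, a)])))))"


section \<open>The unit-capacity instance and the linear program\<close>

text \<open>The copies of \<open>i\<close> are \<open>(i, 0), \<dots>, (i, capacity M i - 1)\<close>.\<close>

definition unit_copies :: "('i, 'j) khd \<Rightarrow> ('i \<times> nat, 'j) khd" where
  "unit_copies M = \<lparr>
     offline = {(i, c). i \<in> offline M \<and> c < capacity M i},
     online = online M,
     edges = {((i, c), j). (i, j) \<in> edges M \<and> c < capacity M i},
     num_prices = num_prices M,
     price = price M,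
     capacity = (\<lambda>_. 1),
     horizon = horizon M,
     arrival = arrival M,
     accept = (\<lambda>((i, c), j, k). accept M (i, j, k)),
     profit = (\<lambda>((i, c), j, k). profit M (i, j, k))\<rparr>"

definition lp_objective :: "('i, 'j) khd \<Rightarrow> (('i, 'j) assignment \<Rightarrow> nat \<Rightarrow> real) \<Rightarrow> real" where
  "lp_objective M x =
     (\<Sum>t\<in>{1..horizon M}. \<Sum>f\<in>assignments M. x f t * accept M f t * profit M f t)"

definition lp_feasible :: "('i, 'j) khd \<Rightarrow> (('i, 'j) assignment \<Rightarrow> nat \<Rightarrow> real) \<Rightarrow> bool" where
  "lp_feasible M x \<longleftrightarrow>
     (\<forall>j\<in>online M. \<forall>t\<in>{1..horizon M}.
        (\<Sum>f\<in>assignments_on M j. x f t) \<le> pmf (arrival M t) j) \<and>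
     (\<forall>i\<in>offline M.
        (\<Sum>t\<in>{1..horizon M}. \<Sum>f\<in>assignments_off M i. x f t * accept M f t) \<le> 1) \<and>
     (\<forall>f\<in>assignments M. \<forall>t\<in>{1..horizon M}. 0 \<le> x f t)"

definition lp_optimal :: "('i, 'j) khd \<Rightarrow> (('i, 'j) assignment \<Rightarrow> nat \<Rightarrow> real) \<Rightarrow> bool" where
  "lp_optimal M x \<longleftrightarrow>
     lp_feasible M x \<and> (\<forall>y. lp_feasible M y \<longrightarrow> lp_objective M y \<le> lp_objective M x)"


section \<open>The policy SAMP\<close>

text \<open>The mass of \<open>None\<close> is the probability that nothing is sampled. That this mass function is
  a probability distribution whenever \<open>x\<close> is feasible is lemma \<open>pmf_samp_draw\<close> below.\<close>

definition samp_mass ::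
  "('i, 'j) khd \<Rightarrow> real \<Rightarrow> (('i, 'j) assignment \<Rightarrow> nat \<Rightarrow> real) \<Rightarrow> nat \<Rightarrow> 'j
     \<Rightarrow> ('i, 'j) assignment option \<Rightarrow> real" where
  "samp_mass M \<gamma> x t j s =
     (case s of
        None \<Rightarrow> 1 - (\<Sum>f\<in>assignments_on M j. \<gamma> * x f t / pmf (arrival M t) j)
      | Some f \<Rightarrow> if f \<in> assignments_on M j then \<gamma> * x f t / pmf (arrival M t) j else 0)"

definition samp_draw ::
  "('i, 'j) khd \<Rightarrow> real \<Rightarrow> (('i, 'j) assignment \<Rightarrow> nat \<Rightarrow> real) \<Rightarrow> nat \<Rightarrow> 'j
     \<Rightarrow> ('i, 'j) assignment option pmf" where
  "samp_draw M \<gamma> x t j = embed_pmf (samp_mass M \<gamma> x t j)"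

definition samp_policy ::
  "('i, 'j) khd \<Rightarrow> real \<Rightarrow> (('i, 'j) assignment \<Rightarrow> nat \<Rightarrow> real) \<Rightarrow> ('i, 'j) policy" where
  "samp_policy M \<gamma> x h t j =
     map_pmf (\<lambda>s. case s of
         None \<Rightarrow> None
       | Some f \<Rightarrow> if has_capacity M h (fst f) then Some f else None)
       (samp_draw M \<gamma> x t j)"

text \<open>Here \<open>x\<close> is meant to be an optimal LP solution for \<open>unit_copies M\<close>.\<close>

definition SAMP ::
  "('i, 'j) khd \<Rightarrow> real \<Rightarrow> (('i \<times> nat, 'j) assignment \<Rightarrow> nat \<Rightarrow> real)
     \<Rightarrow> ('i \<times> nat, 'j) history pmf" where
  "SAMP M \<gamma> x = run (unit_copies M) (samp_policy (unit_copies M) \<gamma> x) (horizon M)"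


section \<open>Well-formedness\<close>

lemma mp_khd_unit_copies:
  assumes "mp_khd M"
  shows "mp_khd (unit_copies M)"
proof -
  have "{(i, c). i \<in> offline M \<and> c < capacity M i} = Sigma (offline M) (\<lambda>i. {..<capacity M i})"
    by auto
  with assms show ?thesis
    unfolding mp_khd_def unit_copies_def assignments_def by fastforce
qed

lemma finite_assignments:
  assumes "mp_khd M"
  shows "finite (assignments M)"
proof (rule finite_subset)
  show "assignments M \<subseteq> offline M \<times> online M \<times> {1..num_prices M}"
    using assms unfolding mp_khd_def assignments_def by auto
  show "finite (offline M \<times> online M \<times> {1..num_prices M})"
    using assms unfolding mp_khd_def by auto
qed

lemma pmf_samp_draw:
  assumes M: "mp_khd M" and x: "lp_feasible M x" and g: "0 \<le> \<gamma>" "\<gamma> \<le> 1"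
    and t: "t \<in> {1..horizon M}" and j: "j \<in> online M"
  shows "pmf (samp_draw M \<gamma> x t j) s = samp_mass M \<gamma> x t j s"
proof -
  let ?F = "assignments_on M j" and ?q = "pmf (arrival M t) j"
  let ?m = "samp_mass M \<gamma> x t j"
  have F: "finite ?F" "?F \<subseteq> assignments M"
    using finite_assignments[OF M] by (auto simp: assignments_on_def)
  have x0: "0 \<le> x f t" if "f \<in> ?F" for f
    using x t that F(2) unfolding lp_feasible_def by blast
  have "(\<Sum>f\<in>?F. x f t) \<le> ?q"
    using x t j unfolding lp_feasible_def by blast
  then have "\<gamma> * (\<Sum>f\<in>?F. x f t) \<le> ?q"
    using g sum_nonneg[of ?F "\<lambda>f. x f t"] x0
    by (meson mult_left_le_one_le order_trans)
  then have le1: "(\<Sum>f\<in>?F. \<gamma> * x f t / ?q) \<le> 1"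
    by (simp add: sum_divide_distrib[symmetric] sum_distrib_left[symmetric] divide_le_eq_1
        less_le)
  have nonneg: "0 \<le> ?m s" for s
    using le1 x0 g by (auto simp: samp_mass_def split: option.split)
  let ?S = "insert None (Some ` ?F)"
  have out: "?m s = 0" if "s \<notin> ?S" for s
    using that by (auto simp: samp_mass_def split: option.split)
  have "(\<integral>\<^sup>+s. ennreal (?m s) \<partial>count_space UNIV) = (\<Sum>s\<in>?S. ennreal (?m s))"
    by (rule nn_integral_count_space') (use F out in auto)
  also have "\<dots> = ennreal (\<Sum>s\<in>?S. ?m s)"
    using nonneg by simp
  also have "(\<Sum>s\<in>?S. ?m s) = 1"
    using F by (simp add: sum.reindex samp_mass_def cong: sum.cong)
  finally have "(\<integral>\<^sup>+s. ennreal (?m s) \<partial>count_space UNIV) = 1"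
    by simp
  then show ?thesis
    unfolding samp_draw_def using nonneg by (intro pmf_embed_pmf) auto
qed

end

theory Submission
  imports Defs
begin

text \<open>On the unit-capacity instance \<open>H\<close> counts the copies that are ever matched. Given that no
  copy in a set \<open>A\<close> has been matched so far, round \<open>t\<close> matches one with probability \<open>\<gamma>\<close> times the
  LP load of \<open>A\<close> in that round, whatever the history; so \<open>A\<close> stays unmatched with probability
  $\prod_t (1 - \gamma\,\mathrm{load}_t(A))$. Since loads add up, the events ``copy \<open>i\<close> stays
  unmatched'' are pairwise negatively correlated, and the variance of \<open>H\<close> is at most the sum of
  the Bernoulli variances. By the LP capacity constraint each copy is matched with probability
  at most \<open>\<gamma>\<close>.\<close>

section \<open>Probability\<close>

lemma measure_bind_pmf:
  "measure (measure_pmf (bind_pmf p f)) X = (\<integral>y. measure (measure_pmf (f y)) X \<partial>measure_pmf p)"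
proof -
  have "ennreal (measure (measure_pmf (bind_pmf p f)) X)
      = (\<integral>\<^sup>+y. ennreal (measure (measure_pmf (f y)) X) \<partial>measure_pmf p)"
    by (simp flip: measure_pmf.emeasure_eq_measure)
  also have "\<dots> = ennreal (\<integral>y. measure (measure_pmf (f y)) X \<partial>measure_pmf p)"
    by (intro nn_integral_eq_integral measure_pmf.integrable_const_bound[where B = 1]) auto
  finally show ?thesis
    by (simp add: integral_nonneg_AE)
qed

text \<open>The variance is a double sum of covariances; those off the diagonal are at most 0 and
  the diagonal ones are Bernoulli variances. Complements are counted because the events of staying
  unmatched are the ones with an explicit probability.\<close>

lemma variance_count_neg_correlated:
  fixes p :: "'a pmf"
  assumes fin: "finite I"
    and neg: "\<And>i j. i \<in> I \<Longrightarrow> j \<in> I \<Longrightarrow> i \<noteq> j \<Longrightarrow>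
      measure p (E i \<inter> E j) \<le> measure p (E i) * measure p (E j)"
  shows "measure_pmf.variance p (\<lambda>w. \<Sum>i\<in>I. 1 - indicator (E i) w)
    \<le> (\<Sum>i\<in>I. measure p (E i) * (1 - measure p (E i)))"
proof -
  let ?P = "\<lambda>A. measure p A"
  define N :: "'a \<Rightarrow> real" where "N w = (\<Sum>i\<in>I. indicator (E i) w)" for w
  have sq: "(N w)\<^sup>2 = (\<Sum>i\<in>I. \<Sum>j\<in>I. indicator (E i \<inter> E j) w)" for w
    by (simp add: N_def power2_eq_square sum_product indicator_inter_arith)
  have ind: "integrable p (indicator A :: 'a \<Rightarrow> real)" for A
    by (simp add: measure_pmf.emeasure_eq_measure)
  have intN: "integrable p N" "integrable p (\<lambda>w. (N w)\<^sup>2)"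
    unfolding sq unfolding N_def by (intro Bochner_Integration.integrable_sum ind)+
  have EN: "measure_pmf.expectation p N = (\<Sum>i\<in>I. ?P (E i))"
    unfolding N_def by (subst Bochner_Integration.integral_sum) (auto intro: ind)
  have EN2: "measure_pmf.expectation p (\<lambda>w. (N w)\<^sup>2) = (\<Sum>i\<in>I. \<Sum>j\<in>I. ?P (E i \<inter> E j))"
    unfolding sq
    by (subst Bochner_Integration.integral_sum, intro Bochner_Integration.integrable_sum ind,
        subst Bochner_Integration.integral_sum) (auto intro: ind)
  \<comment> \<open>The count is \<open>card I - N\<close>, and variance is invariant under
    reflection and translation.\<close>
  have "measure_pmf.variance p (\<lambda>w. \<Sum>i\<in>I. 1 - indicator (E i) w)
      = measure_pmf.variance p N"
  proof -
    have eq: "(\<Sum>i\<in>I. 1 - indicator (E i) w) = real (card I) - N w" for w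
      by (simp add: N_def sum_subtractf)
    have "measure_pmf.expectation p (\<lambda>w. real (card I) - N w)
        = real (card I) - measure_pmf.expectation p N"
      using intN by simp
    moreover have "(c - a - (c - b))\<^sup>2 = (a - b)\<^sup>2" for a b c :: real
      by (simp add: power2_eq_square algebra_simps)
    ultimately show ?thesis
      by (simp only: eq)
  qed
  also have "\<dots> = (\<Sum>i\<in>I. \<Sum>j\<in>I. ?P (E i \<inter> E j)) - (\<Sum>i\<in>I. ?P (E i))\<^sup>2"
    using measure_pmf.variance_eq[OF intN] by (simp only: EN EN2)
  also have "\<dots> = (\<Sum>i\<in>I. \<Sum>j\<in>I. ?P (E i \<inter> E j) - ?P (E i) * ?P (E j))"
    by (simp add: power2_eq_square sum_product sum_subtractf)
  also have "\<dots> \<le> (\<Sum>i\<in>I. \<Sum>j\<in>I. if i = j then ?P (E i) * (1 - ?P (E i)) else 0)"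
    by (intro sum_mono) (auto simp: algebra_simps dest: neg)
  also have "\<dots> = (\<Sum>i\<in>I. ?P (E i) * (1 - ?P (E i)))"
    using fin by simp
  finally show ?thesis .
qed

text \<open>The source of the truncation at 1/2: p(1 - p) increases up to p = 1/2 and never exceeds
  its value 1/4 there.\<close>

lemma bernoulli_variance_mono:
  fixes p c :: real
  assumes "0 \<le> p" "p \<le> c"
  shows "p * (1 - p) \<le> min (1/2) c * (1 - min (1/2) c)"
proof (cases "c \<le> 1/2")
  case True
  \<comment> \<open>This product equals c(1 - c) - p(1 - p).\<close>
  then have "0 \<le> (c - p) * (1 - c - p)"
    using assms by (intro mult_nonneg_nonneg) auto
  moreover have "min (1/2) c = c"
    using True by simp
  ultimately show ?thesis
    by (simp add: algebra_simps)
next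
  case False
  then show ?thesis
    using zero_le_square[of "p - 1/2"] by (simp add: min_def algebra_simps)
qed


section \<open>Histories\<close>

text \<open>The law of a single history entry, split off from \<open>run\<close> so that one round
  can be analysed for a fixed past.\<close>

definition round_pmf ::
  "('i, 'j) khd \<Rightarrow> ('i, 'j) policy \<Rightarrow> ('i, 'j) history \<Rightarrow> nat
     \<Rightarrow> ('j \<times> ('i, 'j) assignment option \<times> bool) pmf" where
  "round_pmf M P h t =
     bind_pmf (arrival M t) (\<lambda>j. bind_pmf (P h t j) (\<lambda>s.
       map_pmf (\<lambda>a. (j, s, a)) (acceptance M t s)))"

lemma run_Suc_round:
  "run M P (Suc n) = bind_pmf (run M P n) (\<lambda>h. map_pmf (\<lambda>r. h @ [r]) (round_pmf M P h (Suc n)))"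
  by (simp add: round_pmf_def map_pmf_def bind_assoc_pmf bind_return_pmf)

definition hits :: "'i set \<Rightarrow> ('j \<times> ('i, 'j) assignment option \<times> bool) set" where
  "hits A = {(j, s, a). a \<and> (\<exists>f. s = Some f \<and> fst f \<in> A)}"

definition avoids :: "'i set \<Rightarrow> ('i, 'j) history set" where
  "avoids A = {h. \<forall>f\<in>set (successes h). fst f \<notin> A}"

lemma successes_snoc:
  "successes (h @ [(j, s, a)]) =
     successes h @ (case s of None \<Rightarrow> [] | Some f \<Rightarrow> if a then [f] else [])"
  by (auto simp: successes_def split: option.split)

lemma avoids_snoc: "h @ [r] \<in> avoids A \<longleftrightarrow> h \<in> avoids A \<and> r \<notin> hits A"
  by (cases r) (auto simp: avoids_def hits_def successes_snoc split: option.split)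

text \<open>Joint survival of two copies is again an event of the form \<open>avoids\<close>, so one
  formula for arbitrary sets also covers pairs.\<close>

lemma avoids_Un: "avoids (A \<union> B) = avoids A \<inter> avoids B"
  by (auto simp: avoids_def)

text \<open>If no copy is matched twice, the number of successes is the number of distinct matched
  copies.\<close>

lemma num_successes_conv_avoids:
  assumes "distinct (map fst (successes h))" "fst ` set (successes h) \<subseteq> I" "finite I"
  shows "real (num_successes h) = (\<Sum>i\<in>I. 1 - indicator (avoids {i}) h)"
proof -
  have "num_successes h = card (fst ` set (successes h))"
    using distinct_card[OF assms(1)] by (simp add: num_successes_def)
  also have "real \<dots> = (\<Sum>i\<in>I. if i \<in> fst ` set (successes h) then 1 else 0)"
    using assms by (simp add: sum.If_cases Int_absorb1)
  also have "\<dots> = (\<Sum>i\<in>I. 1 - indicator (avoids {i}) h)"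
    by (intro sum.cong) (auto simp: avoids_def indicator_def)
  finally show ?thesis .
qed


section \<open>SAMP on unit-capacity instances\<close>

locale unit_samp =
  fixes M :: "('i, 'j) khd" and \<gamma> :: real and x :: "('i, 'j) assignment \<Rightarrow> nat \<Rightarrow> real"
  assumes M: "mp_khd M" and unit: "\<And>i. capacity M i = 1"
    and g: "0 \<le> \<gamma>" "\<gamma> \<le> 1" and x: "lp_feasible M x"
begin

text \<open>The round-t share of the left side of the LP capacity constraint, summed over the copies
  in \<open>A\<close>.\<close>

definition load :: "'i set \<Rightarrow> nat \<Rightarrow> real" where
  "load A t = (\<Sum>f | f \<in> assignments M \<and> fst f \<in> A. x f t * accept M f t)"

lemma has_capacity_iff: "has_capacity M h i \<longleftrightarrow> h \<in> avoids {i}"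
  by (auto simp: has_capacity_def avoids_def unit filter_empty_conv)

lemma x_nonneg: "f \<in> assignments M \<Longrightarrow> t \<in> {1..horizon M} \<Longrightarrow> 0 \<le> x f t"
  using x unfolding lp_feasible_def by blast

lemma accept_bounds:
  "f \<in> assignments M \<Longrightarrow> t \<in> {1..horizon M} \<Longrightarrow> 0 \<le> accept M f t \<and> accept M f t \<le> 1"
  using M unfolding mp_khd_def by (meson less_imp_le)

lemma load_nonneg: "t \<in> {1..horizon M} \<Longrightarrow> 0 \<le> load A t"
  unfolding load_def by (intro sum_nonneg mult_nonneg_nonneg) (auto simp: x_nonneg accept_bounds)

lemma load_Un: "A \<inter> B = {} \<Longrightarrow> load (A \<union> B) t = load A t + load B t"
  unfolding load_def
  by (subst sum.union_disjoint[symmetric])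
     (auto intro: finite_subset[OF _ finite_assignments[OF M]] intro!: sum.cong)

lemma sum_load_le: "i \<in> offline M \<Longrightarrow> (\<Sum>t\<in>{1..horizon M}. load {i} t) \<le> 1"
  using x by (simp add: load_def lp_feasible_def assignments_off_def)

lemma arrival_online: "t \<in> {1..horizon M} \<Longrightarrow> j \<in> set_pmf (arrival M t) \<Longrightarrow> j \<in> online M"
  using M unfolding mp_khd_def by blast

section \<open>Matching probabilities in a single round\<close>

lemma set_samp_draw:
  assumes "t \<in> {1..horizon M}" "j \<in> online M"
  shows "set_pmf (samp_draw M \<gamma> x t j) \<subseteq> insert None (Some ` assignments_on M j)"
proof
  fix s assume "s \<in> set_pmf (samp_draw M \<gamma> x t j)"
  then have "samp_mass M \<gamma> x t j s \<noteq> 0"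
    by (simp add: set_pmf_iff pmf_samp_draw[OF M x g assms])
  then show "s \<in> insert None (Some ` assignments_on M j)"
    by (auto simp: samp_mass_def split: option.splits if_splits)
qed

text \<open>Sampling divides by the arrival probability, and division by 0 yields 0 here. The LP
  arrival constraint makes \<open>x\<close> vanish in that case, so multiplying back still recovers
  \<open>x\<close>.\<close>

lemma x_eq_0:
  assumes "t \<in> {1..horizon M}" "j \<in> online M" "f \<in> assignments_on M j" "pmf (arrival M t) j = 0"
  shows "x f t = 0"
proof -
  have "(\<Sum>f\<in>assignments_on M j. x f t) \<le> 0"
    using x assms unfolding lp_feasible_def by force
  moreover have "x f t \<le> (\<Sum>f\<in>assignments_on M j. x f t)"
    using assms finite_assignments[OF M]
    by (intro member_le_sum) (auto simp: assignments_on_def x_nonneg)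
  moreover have "0 \<le> x f t"
    using assms by (auto simp: assignments_on_def x_nonneg)
  ultimately show ?thesis by simp
qed

text \<open>As \<open>h\<close> avoids \<open>A\<close>, every copy in \<open>A\<close> is still
  free and the capacity check never discards a sample for \<open>A\<close>. What remains is the
  sampling probability times the acceptance probability.\<close>

lemma prob_hits_given_arrival:
  assumes t: "t \<in> {1..horizon M}" and j: "j \<in> online M" and h: "h \<in> avoids A"
  shows "measure (bind_pmf (samp_policy M \<gamma> x h t j)
      (\<lambda>s. map_pmf (\<lambda>a. (j, s, a)) (acceptance M t s))) (hits A)
    = (\<Sum>f | f \<in> assignments_on M j \<and> fst f \<in> A. accept M f t * (\<gamma> * x f t / pmf (arrival M t) j))"
proof -
  let ?F = "{f \<in> assignments_on M j. fst f \<in> A}"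
  \<comment> \<open>\<open>sel\<close> is the capacity check of \<open>samp_policy\<close>;
    \<open>acc s\<close> is the probability that the sample \<open>s\<close> leads to a hit.\<close>
  define sel where "sel s = (case s of None \<Rightarrow> None
    | Some f \<Rightarrow> if has_capacity M h (fst f) then Some f else None)"
    for s :: "('i, 'j) assignment option"
  define acc where "acc s = (case s of None \<Rightarrow> 0
    | Some f \<Rightarrow> if f \<in> ?F then accept M f t else 0)" for s
  have fin: "finite ?F"
    using finite_assignments[OF M] by (simp add: assignments_on_def)
  have vim: "(\<lambda>a. (j, s, a)) -` hits A = 
      (case s of None \<Rightarrow> {} | Some f \<Rightarrow> if fst f \<in> A then {True} else {})"
    for s :: "('i, 'j) assignment option"
    by (auto simp: hits_def split: option.split)
  have acc: "measure (map_pmf (\<lambda>a. (j, sel s, a)) (acceptance M t (sel s))) (hits A) = acc s"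
    if "s \<in> set_pmf (samp_draw M \<gamma> x t j)" for s
  proof (cases s)
    case None
    then show ?thesis by (simp add: sel_def acc_def vim)
  next
    case (Some f)
    then have f: "f \<in> assignments_on M j"
      using that set_samp_draw[OF t j] by auto
    then have "0 \<le> accept M f t" "accept M f t \<le> 1"
      using accept_bounds t by (auto simp: assignments_on_def)
    moreover have "has_capacity M h (fst f)" if "fst f \<in> A"
      using that h by (auto simp: has_capacity_iff avoids_def)
    ultimately show ?thesis
      using f Some by (auto simp: sel_def acc_def vim acceptance_def measure_pmf_single)
  qed
  have "measure (bind_pmf (samp_policy M \<gamma> x h t j)
      (\<lambda>s. map_pmf (\<lambda>a. (j, s, a)) (acceptance M t s))) (hits A)
    = (\<integral>s. measure (map_pmf (\<lambda>a. (j, sel s, a)) (acceptance M t (sel s))) (hits A)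
        \<partial>measure_pmf (samp_draw M \<gamma> x t j))"
    by (simp add: measure_bind_pmf samp_policy_def sel_def[abs_def] del: measure_map_pmf)
  also have "\<dots> = (\<integral>s. acc s \<partial>measure_pmf (samp_draw M \<gamma> x t j))"
    by (intro integral_cong_AE) (auto simp: AE_measure_pmf_iff acc simp del: measure_map_pmf)
  also have "\<dots> = (\<Sum>s\<in>Some ` ?F. acc s * pmf (samp_draw M \<gamma> x t j) s)"
    using fin by (intro integral_measure_pmf_real)
      (auto simp: acc_def split: option.splits if_splits)
  also have "\<dots> = (\<Sum>f\<in>?F. accept M f t * (\<gamma> * x f t / pmf (arrival M t) j))"
    by (auto simp: sum.reindex acc_def pmf_samp_draw[OF M x g t j] samp_mass_def intro!: sum.cong)
  finally show ?thesis .
qed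

text \<open>Averaging over arrivals cancels the arrival probabilities. The history enters only
  through membership in \<open>avoids A\<close>.\<close>

lemma prob_hits:
  assumes t: "t \<in> {1..horizon M}" and h: "h \<in> avoids A"
  shows "measure (round_pmf M (samp_policy M \<gamma> x) h t) (hits A) = \<gamma> * load A t"
proof -
  let ?F = "\<lambda>j. {f \<in> assignments_on M j. fst f \<in> A}" and ?q = "pmf (arrival M t)"
  let ?m = "\<lambda>j. measure (bind_pmf (samp_policy M \<gamma> x h t j)
      (\<lambda>s. map_pmf (\<lambda>a. (j, s, a)) (acceptance M t s))) (hits A)"
  have fin: "finite (online M)"
    using M by (simp add: mp_khd_def)
  have "measure (round_pmf M (samp_policy M \<gamma> x) h t) (hits A)
      = (\<integral>j. ?m j \<partial>measure_pmf (arrival M t))"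
    unfolding round_pmf_def by (rule measure_bind_pmf)
  also have "\<dots> = (\<Sum>j\<in>online M. ?m j * ?q j)"
    using fin arrival_online[OF t] by (intro integral_measure_pmf_real) auto
  also have "\<dots> = (\<Sum>j\<in>online M. \<Sum>f\<in>?F j. \<gamma> * (x f t * accept M f t))"
  proof (intro sum.cong refl)
    fix j assume j: "j \<in> online M"
    have "?m j * ?q j = (\<Sum>f\<in>?F j. accept M f t * (\<gamma> * x f t / ?q j) * ?q j)"
      by (simp add: prob_hits_given_arrival[OF t j h] sum_distrib_right)
    also have "\<dots> = (\<Sum>f\<in>?F j. \<gamma> * (x f t * accept M f t))"
      using x_eq_0[OF t j] by (intro sum.cong) auto
    finally show "?m j * ?q j = (\<Sum>f\<in>?F j. \<gamma> * (x f t * accept M f t))" .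
  qed
  also have "\<dots> = (\<Sum>f\<in>(\<Union>j\<in>online M. ?F j). \<gamma> * (x f t * accept M f t))"
    using fin finite_assignments[OF M]
    by (intro sum.UNION_disjoint[symmetric]) (auto simp: assignments_on_def)
  \<comment> \<open>Every edge ends in \<open>online M\<close>, so grouping by online type loses no
    assignment.\<close>
  also have "(\<Union>j\<in>online M. ?F j) = {f. f \<in> assignments M \<and> fst f \<in> A}"
    using M by (fastforce simp: assignments_on_def assignments_def mp_khd_def)
  finally show ?thesis
    by (simp add: load_def sum_distrib_left)
qed

text \<open>The empty history avoids every set, so this quantity is itself a probability.\<close>

lemma load_le:
  assumes "t \<in> {1..horizon M}"
  shows "\<gamma> * load A t \<le> 1"
proof -
  have "[] \<in> avoids A"
    by (simp add: avoids_def successes_def)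
  from prob_hits[OF assms this] show ?thesis
    using measure_pmf.prob_le_1 by metis
qed

section \<open>Survival probabilities and invariants of a run\<close>

lemma prob_avoids:
  "n \<le> horizon M \<Longrightarrow>
    measure (run M (samp_policy M \<gamma> x) n) (avoids A) = (\<Prod>t\<in>{1..n}. 1 - \<gamma> * load A t)"
proof (induction n)
  case 0
  show ?case by (simp add: avoids_def successes_def)
next
  case (Suc n)
  let ?P = "samp_policy M \<gamma> x"
  have t: "Suc n \<in> {1..horizon M}"
    using Suc.prems by simp
  \<comment> \<open>A hit is never undone, which gives the indicator; the other factor is the same
    for all surviving histories and leaves the integral.\<close>
  have step: "measure (map_pmf (\<lambda>r. h @ [r]) (round_pmf M ?P h (Suc n))) (avoids A)
      = (1 - \<gamma> * load A (Suc n)) * indicator (avoids A) h" for h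
  proof (cases "h \<in> avoids A")
    case True
    then have "(\<lambda>r. h @ [r]) -` avoids A = UNIV - hits A"
      by (auto simp: avoids_snoc)
    then show ?thesis
      using True prob_hits[OF t True]
        measure_pmf.prob_compl[of "hits A" "round_pmf M ?P h (Suc n)"] by simp
  next
    case False
    then have "(\<lambda>r. h @ [r]) -` avoids A = {}"
      by (auto simp: avoids_snoc)
    with False show ?thesis by simp
  qed
  have "measure (run M ?P (Suc n)) (avoids A)
      = (\<integral>h. (1 - \<gamma> * load A (Suc n)) * indicator (avoids A) h \<partial>measure_pmf (run M ?P n))"
    by (simp only: run_Suc_round measure_bind_pmf step)
  also have "\<dots> = (1 - \<gamma> * load A (Suc n)) * measure (run M ?P n) (avoids A)"
    by simp
  also have "\<dots> = (\<Prod>t\<in>{1..Suc n}. 1 - \<gamma> * load A t)"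
    using Suc by (simp add: mult.commute)
  finally show ?case .
qed

text \<open>A copy is selected only while it is unmatched, so it cannot succeed twice. This supplies
  the hypotheses of \<open>num_successes_conv_avoids\<close>.\<close>

lemma run_successes:
  "n \<le> horizon M \<Longrightarrow> h \<in> set_pmf (run M (samp_policy M \<gamma> x) n) \<Longrightarrow>
    distinct (map fst (successes h)) \<and> fst ` set (successes h) \<subseteq> offline M"
proof (induction n arbitrary: h)
  case 0
  then show ?case by (simp add: successes_def)
next
  case (Suc n)
  let ?P = "samp_policy M \<gamma> x"
  have t: "Suc n \<in> {1..horizon M}"
    using Suc.prems by simp
  from Suc.prems(2) obtain h' j s a where h': "h' \<in> set_pmf (run M ?P n)"
    and j: "j \<in> set_pmf (arrival M (Suc n))" and s: "s \<in> set_pmf (?P h' (Suc n) j)"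
    and h: "h = h' @ [(j, s, a)]"
    by auto
  have IH: "distinct (map fst (successes h'))" "fst ` set (successes h') \<subseteq> offline M"
    using Suc.IH[OF _ h'] Suc.prems by auto
  have sel: "f \<in> assignments M \<and> h' \<in> avoids {fst f}" if "s = Some f" for f
    using s that set_samp_draw[OF t arrival_online[OF t j]]
    by (force simp: samp_policy_def has_capacity_iff assignments_on_def
        split: option.splits if_splits)
  have off: "fst f \<in> offline M" if "f \<in> assignments M" for f
    using that M by (auto simp: assignments_def mp_khd_def)
  show ?case
  proof (cases s)
    case None
    then show ?thesis
      using IH by (simp add: h successes_snoc)
  next
    case (Some f)
    then have "fst f \<notin> fst ` set (successes h')" "fst f \<in> offline M"
      using sel off by (auto simp: avoids_def)
    then show ?thesis
      using IH Some by (simp add: h successes_snoc)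
  qed
qed

section \<open>The variance bound\<close>

lemma variance_num_successes:
  "measure_pmf.variance (run M (samp_policy M \<gamma> x) (horizon M)) (\<lambda>h. real (num_successes h))
    \<le> min (1/2) \<gamma> * (1 - min (1/2) \<gamma>) * real (card (offline M))"
proof -
  define R where "R = run M (samp_policy M \<gamma> x) (horizon M)"
  let ?T = "{1..horizon M}"
  have prob: "measure R (avoids A) = (\<Prod>t\<in>?T. 1 - \<gamma> * load A t)" for A
    unfolding R_def by (rule prob_avoids) simp
  have fin: "finite (offline M)"
    using M by (simp add: mp_khd_def)
  have count: "AE h in measure_pmf R.
      real (num_successes h) = (\<Sum>i\<in>offline M. 1 - indicator (avoids {i}) h)"
    unfolding AE_measure_pmf_iff R_def
    using num_successes_conv_avoids run_successes fin by blast
  have neg: "measure R (avoids {i} \<inter> avoids {j}) \<le> measure R (avoids {i}) * measure R (avoids {j})"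
    if "i \<noteq> j" for i j
  proof -
    have "measure R (avoids {i} \<inter> avoids {j}) = (\<Prod>t\<in>?T. 1 - \<gamma> * load ({i} \<union> {j}) t)"
      by (simp only: prob flip: avoids_Un)
    also have "\<dots> \<le> (\<Prod>t\<in>?T. (1 - \<gamma> * load {i} t) * (1 - \<gamma> * load {j} t))"
    proof (intro prod_mono conjI)
      fix t assume t: "t \<in> ?T"
      \<comment> \<open>Comparing the products factor by factor needs nonnegative smaller factors;
        \<open>load_le\<close> for the two-element set provides this.\<close>
      show "0 \<le> 1 - \<gamma> * load ({i} \<union> {j}) t"
        using load_le[OF t] by simp
      have "0 \<le> (\<gamma> * load {i} t) * (\<gamma> * load {j} t)"
        using g load_nonneg[OF t] by simp
      \<comment> \<open>With a and b the two scaled loads: 1 - a - b \<le> (1 - a)(1 - b), because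
        ab is nonnegative.\<close>
      then show "1 - \<gamma> * load ({i} \<union> {j}) t \<le> (1 - \<gamma> * load {i} t) * (1 - \<gamma> * load {j} t)"
        using that by (subst load_Un) (auto simp: algebra_simps)
    qed
    also have "\<dots> = measure R (avoids {i}) * measure R (avoids {j})"
      by (simp add: prob prod.distrib)
    finally show ?thesis .
  qed
  have single: "measure R (avoids {i}) * (1 - measure R (avoids {i}))
      \<le> min (1/2) \<gamma> * (1 - min (1/2) \<gamma>)" if i: "i \<in> offline M" for i
  proof -
    have "1 - \<gamma> \<le> 1 - (\<Sum>t\<in>?T. \<gamma> * load {i} t)"
      using mult_left_mono[OF sum_load_le[OF i] g(1)] by (simp add: sum_distrib_left)
    \<comment> \<open>Weierstrass: a product of factors 1 - a with each a in [0, 1] is at least 1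
      minus the sum of the a.\<close>
    also have "\<dots> \<le> measure R (avoids {i})"
      unfolding prob using g load_nonneg load_le
      by (intro Weierstrass_prod_ineq) auto
    finally show ?thesis
      \<comment> \<open>Applied to the probability of being matched, which is at most \<gamma>; p(1
        - p) is symmetric under p to 1 - p.\<close>
      using bernoulli_variance_mono[of "1 - measure R (avoids {i})" \<gamma>] by (simp add: mult.commute)
  qed
  have "measure_pmf.variance R (\<lambda>h. real (num_successes h))
      = measure_pmf.variance R (\<lambda>h. \<Sum>i\<in>offline M. 1 - indicator (avoids {i}) h)"
  proof -
    have "measure_pmf.expectation R (\<lambda>h. real (num_successes h))
        = measure_pmf.expectation R (\<lambda>h. \<Sum>i\<in>offline M. 1 - indicator (avoids {i}) h)"
      using count by (intro integral_cong_AE) auto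
    then show ?thesis
      using count by (intro integral_cong_AE) auto
  qed
  also have "\<dots> \<le> (\<Sum>i\<in>offline M. measure R (avoids {i}) * (1 - measure R (avoids {i})))"
    using fin neg by (intro variance_count_neg_correlated)
  also have "\<dots> \<le> (\<Sum>i\<in>offline M. min (1/2) \<gamma> * (1 - min (1/2) \<gamma>))"
    using single by (rule sum_mono)
  finally show ?thesis
    by (simp add: R_def mult.commute)
qed

end

lemma card_offline_unit_copies:
  assumes "mp_khd M"
  shows "card (offline (unit_copies M)) = (\<Sum>i\<in>offline M. capacity M i)"
proof -
  have "offline (unit_copies M) = Sigma (offline M) (\<lambda>i. {..<capacity M i})"
    by (auto simp: unit_copies_def)
  with assms show ?thesis
    by (simp add: mp_khd_def)
qed

theorem theorem3p3:
  fixes M :: "('i, 'j) khd" and \<gamma> :: real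
    and x :: "('i \<times> nat, 'j) assignment \<Rightarrow> nat \<Rightarrow> real"
  assumes "mp_khd M" and "0 \<le> \<gamma>" and "\<gamma> \<le> 1"
    and "lp_optimal (unit_copies M) x"
  shows "let \<gamma>' = min (1/2) \<gamma>; B = (\<Sum>i\<in>offline M. capacity M i) in
    measure_pmf.variance (SAMP M \<gamma> x) (\<lambda>h. real (num_successes h)) \<le> \<gamma>' * (1 - \<gamma>') * real B"
proof -
  interpret unit_samp "unit_copies M" \<gamma> x
  proof
    show "mp_khd (unit_copies M)"
      using assms(1) by (rule mp_khd_unit_copies)
    show "capacity (unit_copies M) i = 1" for i
      by (simp add: unit_copies_def)
    show "lp_feasible (unit_copies M) x"
      using assms(4) by (simp add: lp_optimal_def)
  qed fact+
  have "horizon (unit_copies M) = horizon M"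
    by (simp add: unit_copies_def)
  then show ?thesis
    using variance_num_successes card_offline_unit_copies[OF assms(1)]
    by (simp only: Let_def SAMP_def)
qed

end
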